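(* Let $\Delta_1,\ldots,\Delta_r\subset\mathbb{R}^n$ be lattice polytopes with $\mathbf{0}\in\Delta_i$ for all $i$, let $\Delta=\Delta_1+\cdots+\Delta_r$ be their Minkowski sum, and assume that $\mathbf{0}$ is an interior point of $\Delta$. Let $A$ be the integral matrix with columns $(\mathbf{e}_i,w)^t\in\mathbb{Z}^r\times\mathbb{Z}^n$, one for each $1\le i\le r$ and $w\in\Delta_i\cap\mathbb{Z}^n$, where $\mathbf{e}_i$ is the $i$-th standard basis vector of $\mathbb{Z}^r$, and let $\beta_0=(-1,\ldots,-1,0,\ldots,0)\in\mathbb{C}^r\times\mathbb{C}^n$. Then there exists a point $x\in V^\vee$ such that $\mathrm{Sol}^0(M_{A,\beta_0},\widehat{\mathcal{O}}_{V^\vee,x})$ has rank (dimension over $\mathbb{C}$) one.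
   Context: Write $\Delta_i\cap\mathbb{Z}^n=\{w_{i,1},\ldots,w_{i,N_i}\}$, $N=N_1+\cdots+N_r$, $V_i=\mathbb{C}^{N_i}$, $V=V_1\times\cdots\times V_r$, and let $\mu_{i,j}=(\mathbf{e}_i,w_{i,j})^t$ be the columns of $A$. Let $x_{i,j}$ ($1\le i\le r$, $1\le j\le N_i$) be the linear coordinates on the dual space $V^\vee$, $\partial_{i,j}=\partial/\partial x_{i,j}$, and $\mathscr{D}=\mathbb{C}[x,\partial]$ the Weyl algebra on $V^\vee$. For $\beta\in\mathbb{C}^{r+n}$, let $I_{A,\beta}\subset\mathscr{D}$ be the left ideal generated by the box operators $\partial^{\nu_+}-\partial^{\nu_-}$ for all $\nu_\pm\in\mathbb{Z}_{\ge0}^N$ with $A\nu_+=A\nu_-$, and by the Euler operators $E_l-\beta_l$, $1\le l\le r+n$, where $E_l=\sum_{i,j}(\mu_{i,j})_l\,x_{i,j}\partial_{i,j}$ and $(\mu_{i,j})_l$ is the $l$-th coordinate of $\mu_{i,j}$. The $A$-hypergeometric system is $M_{A,\beta}=\mathscr{D}/I_{A,\beta}$. $\mathrm{Sol}^0(M,\widehat{\mathcal{O}}_{V^\vee,x})=\mathrm{Hom}_{\mathscr{D}_{V^\vee}}(M,\widehat{\mathcal{O}}_{V^\vee,x})$ is the complex vector space of formal power series solutions of $M$ at $x$. *)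

theory Defs
  imports
    "HOL-Analysis.Analysis"
    "HOL-Library.Poly_Mapping"
    "HOL-Library.Function_Algebras"
    "HOL-Library.Set_Algebras"
begin

text \<open>
  The Weyl algebra is presented below as the free associative algebra on symbols \<open>x_j\<close>, \<open>d_j\<close>
  modulo the canonical commutation relations. The free algebra is the monoid algebra of the
  free monoid, which is written additively because the convolution product of
  \<open>poly_mapping\<close> requires this.
\<close>

datatype 'a free_monoid = Word (letters: "'a list")

instantiation free_monoid :: (type) monoid_add
begin

definition "0 = Word []"
definition "u + v = Word (letters u @ letters v)"

instance
  by standard (simp_all add: zero_free_monoid_def plus_free_monoid_def)

end

datatype 'k generator = X 'k | D 'k

type_synonym 'k free_algebra = "'k generator free_monoid \<Rightarrow>\<^sub>0 complex"

definition gen :: "'k generator \<Rightarrow> 'k free_algebra" where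
  "gen g = Poly_Mapping.single (Word [g]) 1"

text \<open>
  An element \<open>f\<close> of the completed local ring at a point \<open>x\<close> is given by its coefficients: it
  stands for the sum of \<open>f m \<cdot> (\<Prod>j. (x_j - x $ j) ^ m j)\<close> over all multi-indices \<open>m\<close>.
  Accordingly \<open>x_j\<close> acts as \<open>x $ j + (x_j - x $ j)\<close>.
\<close>

type_synonym 'k mfps = "('k \<Rightarrow> nat) \<Rightarrow> complex"

primrec generator_act :: "complex ^ 'k \<Rightarrow> 'k generator \<Rightarrow> 'k mfps \<Rightarrow> 'k mfps" where
  "generator_act x (X j) f =
     (\<lambda>m. x $ j * f m + (if m j = 0 then 0 else f (m(j := m j - 1))))"
| "generator_act x (D j) f = (\<lambda>m. of_nat (m j + 1) * f (m(j := m j + 1)))"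

definition word_act :: "complex ^ 'k \<Rightarrow> 'k generator free_monoid \<Rightarrow> 'k mfps \<Rightarrow> 'k mfps" where
  "word_act x w f = foldr (generator_act x) (letters w) f"

definition free_act :: "complex ^ 'k \<Rightarrow> 'k free_algebra \<Rightarrow> 'k mfps \<Rightarrow> 'k mfps" where
  "free_act x P f =
     (\<lambda>m. \<Sum>w\<in>Poly_Mapping.keys P. Poly_Mapping.lookup P w * word_act x w f m)"

lemma generator_act_add: "generator_act x g (f + h) = generator_act x g f + generator_act x g h"
  by (cases g) (auto simp: fun_eq_iff algebra_simps)

lemma generator_act_scale:
  "generator_act x g (\<lambda>m. c * f m) = (\<lambda>m. c * generator_act x g f m)"
  by (cases g) (auto simp: fun_eq_iff algebra_simps)

lemma word_act_zero_word [simp]: "word_act x 0 f = f"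
  by (simp add: word_act_def zero_free_monoid_def)

lemma word_act_plus_word: "word_act x (u + v) f = word_act x u (word_act x v f)"
  by (simp add: word_act_def plus_free_monoid_def)

lemma word_act_add: "word_act x w (f + h) = word_act x w f + word_act x w h"
proof -
  have "foldr (generator_act x) gs (f + h)
      = foldr (generator_act x) gs f + foldr (generator_act x) gs h" for gs
    by (induction gs) (simp_all only: foldr.simps o_apply id_apply generator_act_add)
  then show ?thesis by (simp add: word_act_def)
qed

lemma word_act_scale: "word_act x w (\<lambda>m. c * f m) = (\<lambda>m. c * word_act x w f m)"
proof -
  have "foldr (generator_act x) gs (\<lambda>m. c * f m)
      = (\<lambda>m. c * foldr (generator_act x) gs f m)" for gs
    by (induction gs) (auto simp: generator_act_scale)
  then show ?thesis by (simp add: word_act_def)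
qed

lemma free_act_superset:
  assumes "finite W" "Poly_Mapping.keys P \<subseteq> W"
  shows "free_act x P f m = (\<Sum>w\<in>W. Poly_Mapping.lookup P w * word_act x w f m)"
  unfolding free_act_def
  by (rule sum.mono_neutral_left) (use assms in \<open>auto simp: in_keys_iff\<close>)

lemma free_act_single: "free_act x (Poly_Mapping.single w c) f = (\<lambda>m. c * word_act x w f m)"
proof
  fix m
  show "free_act x (Poly_Mapping.single w c) f m = c * word_act x w f m"
    by (subst free_act_superset[of "{w}"]) (auto simp: lookup_single)
qed

lemma free_act_zero [simp]: "free_act x 0 f = 0"
  by (simp add: free_act_def fun_eq_iff)

lemma free_act_one [simp]: "free_act x 1 f = f"
  unfolding single_one[symmetric] free_act_single by simp

lemma free_act_plus: "free_act x (P + Q) f = free_act x P f + free_act x Q f"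
proof
  fix m
  let ?W = "Poly_Mapping.keys P \<union> Poly_Mapping.keys Q"
  have "Poly_Mapping.keys (P + Q) \<subseteq> ?W" by (rule keys_add)
  then show "free_act x (P + Q) f m = (free_act x P f + free_act x Q f) m"
    by (simp add: free_act_superset[of ?W] lookup_add distrib_right sum.distrib)
qed

lemma free_act_uminus: "free_act x (- P) f = - free_act x P f"
proof -
  have "free_act x (- P) f + free_act x P f = 0"
    by (simp flip: free_act_plus)
  then show ?thesis by (simp add: eq_neg_iff_add_eq_0)
qed

lemma free_act_minus: "free_act x (P - Q) f = free_act x P f - free_act x Q f"
  using free_act_plus[of x P "- Q" f] by (simp add: free_act_uminus)

lemma free_act_add: "free_act x P (f + h) = free_act x P f + free_act x P h"
  by (simp add: free_act_def fun_eq_iff word_act_add distrib_left sum.distrib)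

lemma free_act_scale: "free_act x P (\<lambda>m. c * f m) = (\<lambda>m. c * free_act x P f m)"
  by (simp add: free_act_def fun_eq_iff word_act_scale sum_distrib_left mult.left_commute)

lemma free_act_series_zero [simp]: "free_act x P 0 = 0"
  using free_act_add[of x P 0 0] by simp

lemma free_algebra_induct [case_names single plus]:
  fixes P :: "'a \<Rightarrow>\<^sub>0 'b :: comm_monoid_add"
  assumes "\<And>w c. H (Poly_Mapping.single w c)" "\<And>P Q. H P \<Longrightarrow> H Q \<Longrightarrow> H (P + Q)"
  shows "H P"
proof (induction P rule: update_induct)
  case const
  then show ?case using assms(1)[of _ 0] by simp
next
  case (update f w c)
  have "Poly_Mapping.update w c f = f + Poly_Mapping.single w c"
    using update.hyps
    by (intro poly_mapping_eqI)
       (auto simp: lookup_update lookup_add lookup_single in_keys_iff when_def)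
  then show ?case using assms update.IH by simp
qed

lemma free_act_times: "free_act x (P * Q) f = free_act x P (free_act x Q f)"
proof (induction P arbitrary: Q rule: free_algebra_induct)
  case (single w c)
  show ?case
  proof (induction Q rule: free_algebra_induct)
    case (single v d)
    show ?case
      by (simp add: mult_single free_act_single word_act_plus_word word_act_scale mult.assoc)
  next
    case (plus Q R)
    then show ?case by (simp only: distrib_left free_act_plus free_act_add)
  qed
next
  case (plus P R)
  then show ?case by (simp add: distrib_right free_act_plus)
qed

lemma free_act_gen [simp]: "free_act x (gen g) = generator_act x g"
  by (rule ext) (simp add: gen_def free_act_single word_act_def)

inductive_set weyl_relations :: "'k free_algebra set" where
  XX: "gen (X i) * gen (X j) - gen (X j) * gen (X i) \<in> weyl_relations"
| DD: "gen (D i) * gen (D j) - gen (D j) * gen (D i) \<in> weyl_relations"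
| DX: "gen (D i) * gen (X j) - gen (X j) * gen (D i) - (if i = j then 1 else 0) \<in> weyl_relations"
| plus: "P \<in> weyl_relations \<Longrightarrow> Q \<in> weyl_relations \<Longrightarrow> P + Q \<in> weyl_relations"
| left: "P \<in> weyl_relations \<Longrightarrow> R * P \<in> weyl_relations"
| right: "P \<in> weyl_relations \<Longrightarrow> P * R \<in> weyl_relations"

lemma weyl_relations_act:
  assumes "P \<in> weyl_relations"
  shows "free_act x P f = 0"
  using assms
proof (induction arbitrary: f)
  case (XX i j)
  show ?case
    by (cases "i = j")
       (auto simp: free_act_minus free_act_times fun_eq_iff algebra_simps fun_upd_twist)
next
  case (DD i j)
  show ?case
    by (cases "i = j")
       (auto simp: free_act_minus free_act_times fun_eq_iff algebra_simps fun_upd_twist)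
next
  case (DX i j)
  show ?case
    by (cases "i = j")
       (auto simp: free_act_minus free_act_plus free_act_times fun_eq_iff algebra_simps
          fun_upd_twist of_nat_diff)
qed (auto simp: free_act_plus free_act_times)

lemma weyl_relations_zero: "0 \<in> weyl_relations"
  using weyl_relations.left[OF weyl_relations.XX, of 0] by simp

lemma weyl_relations_uminus: "P \<in> weyl_relations \<Longrightarrow> - P \<in> weyl_relations"
  using weyl_relations.left[of P "- 1"] by simp

lemma one_notin_weyl_relations: "1 \<notin> (weyl_relations :: 'k :: finite free_algebra set)"
proof
  assume "1 \<in> (weyl_relations :: 'k free_algebra set)"
  from weyl_relations_act[OF this, of 0 "\<lambda>_. 1"] show False
    by (simp add: fun_eq_iff)
qed

definition weyl_cong :: "'k free_algebra \<Rightarrow> 'k free_algebra \<Rightarrow> bool" where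
  "weyl_cong P Q \<longleftrightarrow> P - Q \<in> weyl_relations"

quotient_type 'k weyl = "'k free_algebra" / weyl_cong
proof (rule equivpI)
  show "reflp weyl_cong"
    by (simp add: reflp_def weyl_cong_def weyl_relations_zero)
  show "symp weyl_cong"
    unfolding symp_def weyl_cong_def using weyl_relations_uminus by fastforce
  show "transp weyl_cong"
    unfolding transp_def weyl_cong_def using weyl_relations.plus by fastforce
qed

instantiation weyl :: (finite) ring_1
begin

lift_definition zero_weyl :: "'a weyl" is 0 .
lift_definition one_weyl :: "'a weyl" is 1 .
lift_definition plus_weyl :: "'a weyl \<Rightarrow> 'a weyl \<Rightarrow> 'a weyl" is "(+)"
  unfolding weyl_cong_def using weyl_relations.plus by (fastforce simp: algebra_simps)
lift_definition uminus_weyl :: "'a weyl \<Rightarrow> 'a weyl" is uminus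
  unfolding weyl_cong_def using weyl_relations_uminus by fastforce
lift_definition minus_weyl :: "'a weyl \<Rightarrow> 'a weyl \<Rightarrow> 'a weyl" is "(-)"
proof -
  fix P P' Q Q' :: "'a free_algebra"
  assume "weyl_cong P P'" "weyl_cong Q Q'"
  then have "(P - P') + - (Q - Q') \<in> weyl_relations"
    unfolding weyl_cong_def by (intro weyl_relations.plus weyl_relations_uminus)
  then show "weyl_cong (P - Q) (P' - Q')"
    by (simp add: weyl_cong_def algebra_simps)
qed
lift_definition times_weyl :: "'a weyl \<Rightarrow> 'a weyl \<Rightarrow> 'a weyl" is "(*)"
proof -
  fix P P' Q Q' :: "'a free_algebra"
  assume "weyl_cong P P'" "weyl_cong Q Q'"
  then have "(P - P') * Q + P' * (Q - Q') \<in> weyl_relations"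
    unfolding weyl_cong_def
    by (intro weyl_relations.plus weyl_relations.left weyl_relations.right)
  then show "weyl_cong (P * Q) (P' * Q')"
    by (simp add: weyl_cong_def algebra_simps)
qed

instance
proof
  show "(0 :: 'a weyl) \<noteq> 1"
  proof transfer
    show "\<not> weyl_cong 0 (1 :: 'a free_algebra)"
      unfolding weyl_cong_def
      using weyl_relations_uminus[of "0 - 1"] one_notin_weyl_relations by auto
  qed
qed (transfer; simp add: algebra_simps weyl_cong_def weyl_relations_zero)+

end

lift_definition weyl_X :: "'k \<Rightarrow> 'k weyl" is "\<lambda>j. gen (X j)" .
lift_definition weyl_D :: "'k \<Rightarrow> 'k weyl" is "\<lambda>j. gen (D j)" .
lift_definition weyl_const :: "complex \<Rightarrow> 'k weyl" is "\<lambda>c. Poly_Mapping.single 0 c" .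

lemma weyl_D_commute: "weyl_D i * weyl_D j = weyl_D j * weyl_D i"
  by transfer (simp add: weyl_cong_def weyl_relations.DD)

lemma weyl_X_commute: "weyl_X i * weyl_X j = weyl_X j * weyl_X i"
  by transfer (simp add: weyl_cong_def weyl_relations.XX)

lemma weyl_D_X: "weyl_D i * weyl_X j = weyl_X j * weyl_D i + (if i = j then 1 else 0)"
proof -
  have "weyl_D i * weyl_X j - weyl_X j * weyl_D i - (if i = j then 1 else 0) = 0"
    by transfer (simp only: weyl_cong_def diff_zero weyl_relations.DX)
  then show ?thesis by (simp only: diff_diff_eq right_minus_eq)
qed

text \<open>
  The monomial in the derivations with exponent \<open>\<nu>\<close>. As \<open>weyl\<close> is not commutative,
  \<open>prod\<close> does not apply; the order of the factors does not matter by
  \<open>weyl_D_power_comp_fun_commute\<close>.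
\<close>

definition weyl_D_monom :: "('k :: finite \<Rightarrow> nat) \<Rightarrow> 'k weyl" where
  "weyl_D_monom \<nu> = Finite_Set.fold (\<lambda>j P. weyl_D j ^ \<nu> j * P) 1 UNIV"

lemma weyl_D_power_comp_fun_commute: "comp_fun_commute (\<lambda>j P. weyl_D j ^ \<nu> j * P)"
proof
  fix i j
  have "weyl_D i ^ \<nu> i * weyl_D j ^ \<nu> j = weyl_D j ^ \<nu> j * weyl_D i ^ \<nu> i"
    by (rule power_commuting_commutes[OF power_commuting_commutes[OF weyl_D_commute, symmetric],
          symmetric])
  then show "(\<lambda>P. weyl_D i ^ \<nu> i * P) \<circ> (\<lambda>P. weyl_D j ^ \<nu> j * P)
           = (\<lambda>P. weyl_D j ^ \<nu> j * P) \<circ> (\<lambda>P. weyl_D i ^ \<nu> i * P)"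
    by (simp only: fun_eq_iff o_apply mult.assoc[symmetric] simp_thms)
qed

lift_definition weyl_act :: "complex ^ 'k \<Rightarrow> 'k weyl \<Rightarrow> 'k mfps \<Rightarrow> 'k mfps" is free_act
proof -
  fix x :: "complex ^ 'k" and P Q :: "'k free_algebra"
  assume "weyl_cong P Q"
  then have "free_act x (P - Q) f = 0" for f
    unfolding weyl_cong_def by (rule weyl_relations_act)
  then show "free_act x P = free_act x Q"
    by (simp add: fun_eq_iff free_act_minus)
qed

lemma weyl_act_gens [simp]:
  "weyl_act x (weyl_X j) = generator_act x (X j)"
  "weyl_act x (weyl_D j) = generator_act x (D j)"
  by (transfer, simp)+

lemma weyl_act_const [simp]: "weyl_act x (weyl_const c) f = (\<lambda>m. c * f m)"
  by transfer (simp add: free_act_single)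

lemma weyl_act_module:
  "weyl_act x (P + Q) f = weyl_act x P f + weyl_act x Q f"
  "weyl_act x P (f + h) = weyl_act x P f + weyl_act x P h"
  "weyl_act x (P * Q) f = weyl_act x P (weyl_act x Q f)"
  "weyl_act x 1 f = f"
  by (transfer, simp add: free_act_plus free_act_add free_act_times)+

lemma weyl_act_scale: "weyl_act x P (\<lambda>m. c * f m) = (\<lambda>m. c * weyl_act x P f m)"
  by transfer (rule free_act_scale)

definition left_ideal :: "'a :: ring_1 set \<Rightarrow> bool" where
  "left_ideal I \<longleftrightarrow> 0 \<in> I \<and> (\<forall>P\<in>I. \<forall>Q\<in>I. P + Q \<in> I) \<and> (\<forall>R. \<forall>P\<in>I. R * P \<in> I)"

text \<open>
  The underlying set of the left module \<open>R / I\<close>: the cosets of the left ideal \<open>I\<close>.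
  Addition of cosets is elementwise addition of sets, and \<open>R\<close> multiplies a coset \<open>C\<close>
  to the coset \<open>R *o C + I\<close>.
\<close>

definition cosets :: "'a :: ring_1 set \<Rightarrow> 'a set set" where
  "cosets I = range (\<lambda>P. P +o I)"

text \<open>
  \<open>Sol0 I x\<close> is the space of \<open>weyl\<close>-linear maps from \<open>weyl / I\<close> to the formal power series at
  \<open>x\<close>. Linear maps are represented by total functions that are zero off the cosets.
\<close>

definition Sol0 :: "'k weyl set \<Rightarrow> complex ^ 'k \<Rightarrow> ('k weyl set \<Rightarrow> 'k mfps) set" where
  "Sol0 I x = {\<phi>.
     (\<forall>C\<in>cosets I. \<forall>C'\<in>cosets I. \<phi> (C + C') = \<phi> C + \<phi> C') \<and>
     (\<forall>P. \<forall>C\<in>cosets I. \<phi> (P *o C + I) = weyl_act x P (\<phi> C)) \<and>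
     (\<forall>C. C \<notin> cosets I \<longrightarrow> \<phi> C = 0)}"

definition sol_scale :: "complex \<Rightarrow> ('a \<Rightarrow> 'b \<Rightarrow> complex) \<Rightarrow> ('a \<Rightarrow> 'b \<Rightarrow> complex)" where
  "sol_scale c \<phi> = (\<lambda>C m. c * \<phi> C m)"

interpretation sol: vector_space sol_scale
  by standard (auto simp: sol_scale_def fun_eq_iff algebra_simps)

lemma coset_rules:
  fixes I :: "'a :: ring_1 set"
  assumes "left_ideal I"
  shows "(P +o I) + (Q +o I) = (P + Q) +o I" and "R *o (P +o I) + I = (R * P) +o I"
proof -
  have 0: "0 \<in> I" and plus: "\<And>P Q. P \<in> I \<Longrightarrow> Q \<in> I \<Longrightarrow> P + Q \<in> I"
    and times: "\<And>R P. P \<in> I \<Longrightarrow> R * P \<in> I"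
    using assms unfolding left_ideal_def by blast+
  show "(P +o I) + (Q +o I) = (P + Q) +o I"
  proof (intro equalityI subsetI)
    fix a assume "a \<in> (P +o I) + (Q +o I)"
    then obtain b c where bc: "b \<in> I" "c \<in> I" "a = (P + b) + (Q + c)"
      unfolding elt_set_plus_def set_plus_def by blast
    have "a = (P + Q) + (b + c)" using bc(3) by (simp add: add_ac)
    then show "a \<in> (P + Q) +o I" using plus[OF bc(1,2)] by (simp only: set_plus_intro2)
  next
    fix a assume "a \<in> (P + Q) +o I"
    then obtain b where b: "b \<in> I" "a = (P + Q) + b"
      unfolding elt_set_plus_def by blast
    have "a = (P + b) + (Q + 0)" using b(2) by (simp add: add_ac)
    then show "a \<in> (P +o I) + (Q +o I)"
      using set_plus_intro[OF set_plus_intro2[OF b(1)] set_plus_intro2[OF 0]] by simp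
  qed
  show "R *o (P +o I) + I = (R * P) +o I"
  proof (intro equalityI subsetI)
    fix a assume "a \<in> R *o (P +o I) + I"
    then obtain b c where bc: "b \<in> I" "c \<in> I" "a = R * (P + b) + c"
      unfolding elt_set_plus_def elt_set_times_def set_plus_def by blast
    have "a = R * P + (R * b + c)" using bc(3) by (simp add: distrib_left add_ac)
    then show "a \<in> (R * P) +o I"
      using plus[OF times[OF bc(1)] bc(2)] by (simp only: set_plus_intro2)
  next
    fix a assume "a \<in> (R * P) +o I"
    then obtain b where b: "b \<in> I" "a = R * P + b" unfolding elt_set_plus_def by blast
    have "P \<in> P +o I" using set_plus_intro2[OF 0, of P] by simp
    then show "a \<in> R *o (P +o I) + I"
      unfolding b(2) by (intro set_plus_intro set_times_intro2 b(1))
  qed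
qed

lemma subspace_Sol0: "sol.subspace (Sol0 I x)"
proof (rule sol.subspaceI)
  have "weyl_act x P 0 = 0" for P
    using weyl_act_module(2)[of x P 0 0] by simp
  then show "0 \<in> Sol0 I x" by (simp add: Sol0_def)
next
  fix \<phi> \<psi> assume "\<phi> \<in> Sol0 I x" "\<psi> \<in> Sol0 I x"
  then show "\<phi> + \<psi> \<in> Sol0 I x" by (auto simp: Sol0_def weyl_act_module algebra_simps)
next
  fix c \<phi> assume "\<phi> \<in> Sol0 I x"
  then show "sol_scale c \<phi> \<in> Sol0 I x"
    by (auto simp: Sol0_def sol_scale_def weyl_act_scale fun_eq_iff algebra_simps)
qed

definition box_operators :: "int ^ 'k ^ 'd \<Rightarrow> 'k :: finite weyl set" where
  "box_operators A = {weyl_D_monom \<nu> - weyl_D_monom \<nu>' | \<nu> \<nu>'.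
     A *v (\<chi> j. int (\<nu> j)) = A *v (\<chi> j. int (\<nu>' j))}"

definition euler_operator :: "int ^ 'k ^ 'd \<Rightarrow> 'd \<Rightarrow> 'k :: finite weyl" where
  "euler_operator A l = (\<Sum>j\<in>UNIV. of_int (A $ l $ j) * (weyl_X j * weyl_D j))"

definition hypergeometric_ideal ::
    "int ^ 'k ^ 'd \<Rightarrow> complex ^ 'd \<Rightarrow> 'k :: finite weyl set" where
  "hypergeometric_ideal A \<beta> = left_ideal hull
     (box_operators A \<union> range (\<lambda>l. euler_operator A l - weyl_const (\<beta> $ l)))"

definition lattice_point :: "int ^ 'n \<Rightarrow> real ^ 'n" where
  "lattice_point w = (\<chi> m. of_int (w $ m))"

definition lattice_polytope :: "(real ^ 'n) set \<Rightarrow> bool" where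
  "lattice_polytope P \<longleftrightarrow> (\<exists>V. finite V \<and> P = convex hull (lattice_point ` V))"

text \<open>
  The columns of \<open>A\<close> are indexed by an arbitrary finite type \<open>'k\<close>, whose element \<open>j\<close> is
  labelled by a pair \<open>\<mu> j = (i, w)\<close>; the column is \<open>(e_i, w)\<close>. The rows are indexed by the
  disjoint sum \<open>'r + 'n\<close>.
\<close>

definition cayley_matrix :: "('k \<Rightarrow> 'r :: finite \<times> (int ^ 'n)) \<Rightarrow> int ^ 'k ^ ('r + 'n)" where
  "cayley_matrix \<mu> = (\<chi> l j. case l of
     Inl i \<Rightarrow> if i = fst (\<mu> j) then 1 else 0
   | Inr m \<Rightarrow> snd (\<mu> j) $ m)"

definition beta0 :: "complex ^ ('r :: finite + 'n :: finite)" where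
  "beta0 = (\<chi> l. case l of Inl _ \<Rightarrow> - 1 | Inr _ \<Rightarrow> 0)"

end

theory Submission
  imports Defs
begin

text \<open>
  A formal power series is determined by its partial derivatives \<open>g p\<close> at the base point. In
  these coordinates \<open>\<partial>\<^sub>j\<close> is a shift, so the box operators say that \<open>g p\<close> depends only on
  \<open>A p = (d, v)\<close>, and the Euler operators become a recurrence. Take \<open>x\<close> to be the point where
  every Laurent polynomial \<open>f\<^sub>i = \<Sum>\<^sub>j x\<^bsub>i,j\<^esub> t\<^bsup>w\<^esup>\<close>, \<open>w = w\<^bsub>i,j\<^esub>\<close>, is the constant \<open>1\<close>.
  There the Euler operators of \<open>\<int>\<^sup>n\<close> kill all derivatives with \<open>v \<noteq> 0\<close>, and those of \<open>\<int>\<^sup>r\<close>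
  force \<open>g (d + e\<^sub>i, 0) = - (d\<^sub>i + 1) g (d, 0)\<close>. Up to scale the only solution is
  \<open>g (d, 0) = \<Prod>\<^sub>i (-1)\<^bsup>d\<^sub>i\<^esup> d\<^sub>i!\<close>, the series of the constant term of \<open>1 / (f\<^sub>1 \<dots> f\<^sub>r)\<close>.
\<close>

subsection \<open>Solutions as annihilated power series\<close>

lemma weyl_act_zero_right [simp]: "weyl_act x P 0 = 0"
  using weyl_act_module(2)[of x P 0 0] by simp

lemma weyl_act_zero_left [simp]: "weyl_act x 0 f = 0"
  using weyl_act_module(1)[of x 0 0 f] by simp

lemma weyl_act_uminus: "weyl_act x (- P) f = - weyl_act x P f"
proof -
  have "weyl_act x (- P) f + weyl_act x P f = 0"
    by (simp flip: weyl_act_module(1))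
  then show ?thesis by (simp add: eq_neg_iff_add_eq_0)
qed

lemma weyl_act_minus: "weyl_act x (P - Q) f = weyl_act x P f - weyl_act x Q f"
  using weyl_act_module(1)[of x P "- Q" f] by (simp add: weyl_act_uminus)

lemma weyl_act_sum: "weyl_act x (sum P S) f = (\<lambda>m. \<Sum>i\<in>S. weyl_act x (P i) f m)"
  by (induction S rule: infinite_finite_induct) (auto simp: weyl_act_module fun_eq_iff)

lemma weyl_act_of_nat: "weyl_act x (of_nat n) f = (\<lambda>m. of_nat n * f m)"
  by (induction n) (auto simp: weyl_act_module fun_eq_iff algebra_simps)

lemma weyl_act_of_int: "weyl_act x (of_int k) f = (\<lambda>m. of_int k * f m)"
  by (cases k rule: int_cases2) (auto simp: weyl_act_of_nat weyl_act_uminus fun_eq_iff)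

text \<open>The map given by a solution is determined by its value at the coset of 1, and that value
  can be any series killed by \<open>I\<close>. The space \<open>Sol0 I x\<close> is studied through
  this set.\<close>

definition annihilated :: "'k :: finite weyl set \<Rightarrow> complex ^ 'k \<Rightarrow> 'k mfps set" where
  "annihilated I x = {f. \<forall>P\<in>I. weyl_act x P f = 0}"

lemma annihilated_scale: "f \<in> annihilated I x \<Longrightarrow> (\<lambda>m. c * f m) \<in> annihilated I x"
  by (auto simp: annihilated_def weyl_act_scale fun_eq_iff)

lemma annihilated_add:
  "f \<in> annihilated I x \<Longrightarrow> h \<in> annihilated I x \<Longrightarrow> f + h \<in> annihilated I x"
  by (simp add: annihilated_def weyl_act_module)

lemma left_ideal_hull: "left_ideal (left_ideal hull S)"
  by (rule hull_in) (auto simp: left_ideal_def)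

lemma left_ideal_annihilator: "left_ideal {P. weyl_act x P f = 0}"
  by (auto simp: left_ideal_def weyl_act_module)

text \<open>The operators killing a fixed series form a left ideal, so an annihilator that contains
  the generators contains their hull.\<close>

lemma annihilated_hull: "annihilated (left_ideal hull S) x = annihilated S x"
proof
  show "annihilated (left_ideal hull S) x \<subseteq> annihilated S x"
    using hull_subset[of S left_ideal] by (auto simp: annihilated_def)
  show "annihilated S x \<subseteq> annihilated (left_ideal hull S) x"
    using hull_minimal[where S = left_ideal, OF _ left_ideal_annihilator]
    by (fastforce simp: annihilated_def)
qed

lemma left_ideal_minus:
  assumes "left_ideal I" "P \<in> I" "Q \<in> I"
  shows "P - Q \<in> I"
proof -
  have "- 1 * Q \<in> I" using assms unfolding left_ideal_def by blast
  then have "P + - 1 * Q \<in> I" using assms unfolding left_ideal_def by blast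
  then show ?thesis by simp
qed

lemma coset_eq_iff:
  assumes "left_ideal I"
  shows "P +o I = Q +o I \<longleftrightarrow> P - Q \<in> I"
proof
  assume eq: "P +o I = Q +o I"
  have "0 \<in> I" using assms by (simp add: left_ideal_def)
  then have "P \<in> Q +o I" using set_plus_intro2[of 0 I P] by (simp flip: eq)
  then show "P - Q \<in> I" by (auto simp: elt_set_plus_def)
next
  assume PQ: "P - Q \<in> I"
  have sub: "A +o I \<subseteq> B +o I" if "A - B \<in> I" for A B
  proof
    fix a assume "a \<in> A +o I"
    then obtain b where b: "b \<in> I" "a = A + b" unfolding elt_set_plus_def by blast
    have "a = B + ((A - B) + b)" using b by simp
    moreover have "(A - B) + b \<in> I" using assms that b unfolding left_ideal_def by blast
    ultimately show "a \<in> B +o I" by (simp only: set_plus_intro2)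
  qed
  have "0 \<in> I" using assms by (simp add: left_ideal_def)
  then have "Q - P \<in> I" using left_ideal_minus[OF assms _ PQ, of 0] by simp
  then show "P +o I = Q +o I" using PQ sub by blast
qed

text \<open>The quotient module is cyclic: the coset of \<open>P\<close> is \<open>P\<close> times
  the coset of 1.\<close>

lemma Sol0_coset:
  assumes "left_ideal I" "\<phi> \<in> Sol0 I x"
  shows "\<phi> (P +o I) = weyl_act x P (\<phi> (1 +o I))"
proof -
  have "\<phi> (P *o (1 +o I) + I) = weyl_act x P (\<phi> (1 +o I))"
    using assms(2) by (auto simp: Sol0_def cosets_def)
  then show ?thesis by (simp add: coset_rules(2)[OF assms(1)])
qed

lemma Sol0_annihilated:
  assumes "left_ideal I" "\<phi> \<in> Sol0 I x"
  shows "\<phi> (1 +o I) \<in> annihilated I x"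
proof -
  have "weyl_act x P (\<phi> (1 +o I)) = 0" if "P \<in> I" for P
  proof -
    have "P +o I = 0 +o I" using that by (simp only: coset_eq_iff[OF assms(1)] diff_zero)
    then show ?thesis using Sol0_coset[OF assms, of P] Sol0_coset[OF assms, of 0] by simp
  qed
  then show ?thesis by (simp add: annihilated_def)
qed

lemma Sol0_eqI:
  assumes "left_ideal I" "\<phi> \<in> Sol0 I x" "\<psi> \<in> Sol0 I x" "\<phi> (1 +o I) = \<psi> (1 +o I)"
  shows "\<phi> = \<psi>"
proof
  fix C show "\<phi> C = \<psi> C"
  proof (cases "C \<in> cosets I")
    case True
    then obtain P where "C = P +o I" by (auto simp: cosets_def)
    then show ?thesis
      using Sol0_coset[OF assms(1,2), of P] Sol0_coset[OF assms(1,3), of P] assms(4) by simp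
  next
    case False
    then show ?thesis using assms by (simp add: Sol0_def)
  qed
qed

lemma Sol0_ex:
  assumes I: "left_ideal I" and f: "f \<in> annihilated I x"
  shows "\<exists>\<phi>\<in>Sol0 I x. \<phi> (1 +o I) = f"
proof -
  \<comment> \<open>Any representative of the coset gives the same value because \<open>f\<close> is
    killed by \<open>I\<close>. Off the cosets the value is 0, as \<open>Sol0\<close>
    requires.\<close>
  define \<phi> where
    "\<phi> C = (if C \<in> cosets I then weyl_act x (SOME P. C = P +o I) f else 0)" for C
  have coset: "\<phi> (P +o I) = weyl_act x P f" for P
  proof -
    define Q where "Q = (SOME Q. P +o I = Q +o I)"
    have "P +o I = Q +o I" unfolding Q_def by (rule someI[of _ P]) simp
    then have "weyl_act x (P - Q) f = 0"
      using f coset_eq_iff[OF I] by (simp add: annihilated_def)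
    then show ?thesis by (simp add: \<phi>_def cosets_def weyl_act_minus flip: Q_def)
  qed
  have "\<phi> \<in> Sol0 I x"
    by (auto simp: Sol0_def cosets_def coset coset_rules[OF I] weyl_act_module)
       (auto simp: \<phi>_def cosets_def)
  then show ?thesis using coset[of 1] by (auto simp: weyl_act_module)
qed

text \<open>Evaluation at the coset of 1 is linear and injective on \<open>Sol0 I x\<close>, so a
  preimage of \<open>f\<close> spans the space.\<close>

lemma dim_Sol0_eq_1:
  assumes I: "left_ideal I" and f: "f \<in> annihilated I x" "f \<noteq> 0"
    and uniq: "\<And>h. h \<in> annihilated I x \<Longrightarrow> \<exists>c. h = (\<lambda>m. c * f m)"
  shows "sol.dim (Sol0 I x) = 1"
proof -
  obtain \<phi> where \<phi>: "\<phi> \<in> Sol0 I x" "\<phi> (1 +o I) = f" using Sol0_ex[OF I f(1)] by blast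
  have "\<psi> \<in> sol.span {\<phi>}" if \<psi>: "\<psi> \<in> Sol0 I x" for \<psi>
  proof -
    obtain c where c: "\<psi> (1 +o I) = (\<lambda>m. c * f m)"
      using uniq[OF Sol0_annihilated[OF I \<psi>]] by blast
    have "sol_scale c \<phi> \<in> Sol0 I x"
      using subspace_Sol0 \<phi>(1) by (rule sol.subspace_scale)
    moreover have "sol_scale c \<phi> (1 +o I) = \<psi> (1 +o I)" by (simp add: sol_scale_def \<phi> c)
    ultimately have "\<psi> = sol_scale c \<phi>" using Sol0_eqI[OF I] \<psi> by metis
    then show ?thesis by (simp add: sol.span_base sol.span_scale)
  qed
  moreover have "\<phi> \<noteq> 0" using \<phi> f by auto
  ultimately show ?thesis
    using \<phi>(1) by (intro sol.dim_unique[of "{\<phi>}"] subsetI) simp_all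
qed

subsection \<open>Taylor coordinates\<close>

text \<open>Exponential normalisation: the factorials absorb the coefficient \<open>m j + 1\<close>
  in the action of \<open>D j\<close>, which becomes a pure shift of \<open>g\<close>.\<close>

definition taylor :: "(('k :: finite \<Rightarrow> nat) \<Rightarrow> complex) \<Rightarrow> 'k mfps" where
  "taylor g = (\<lambda>p. g p / (\<Prod>j\<in>UNIV. fact (p j)))"

lemma taylor_inject [simp]: "taylor g = taylor h \<longleftrightarrow> g = h"
  by (auto simp: taylor_def fun_eq_iff)

lemma taylor_eq_0_iff [simp]: "taylor g = 0 \<longleftrightarrow> g = 0"
  by (auto simp: taylor_def fun_eq_iff)

lemma taylor_surj: "\<exists>g. f = taylor g"
  by (rule exI[of _ "\<lambda>p. f p * (\<Prod>j\<in>UNIV. fact (p j))"]) (simp add: taylor_def)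

lemma prod_fact_upd_Suc:
  fixes p :: "'k :: finite \<Rightarrow> nat"
  shows "(\<Prod>i\<in>UNIV. fact ((p(j := Suc (p j))) i) :: complex)
    = of_nat (Suc (p j)) * (\<Prod>i\<in>UNIV. fact (p i))"
proof -
  have "(\<Prod>i\<in>UNIV - {j}. fact ((p(j := Suc (p j))) i) :: complex)
    = (\<Prod>i\<in>UNIV - {j}. fact (p i))"
    by (rule prod.cong) auto
  then show ?thesis
    by (simp add: prod.remove[of UNIV j] mult.assoc del: of_nat_Suc)
qed

lemma act_D_taylor:
  "generator_act x (D j) (taylor g) = taylor (\<lambda>p. g (p(j := Suc (p j))))"
proof
  fix p :: "'a \<Rightarrow> nat"
  show "generator_act x (D j) (taylor g) p = taylor (\<lambda>p. g (p(j := Suc (p j)))) p"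
    using prod_fact_upd_Suc[of p j] of_nat_neq_0[of "p j", where ?'a = complex]
    by (simp add: taylor_def del: of_nat_Suc fun_upd_apply)
qed

text \<open>\<open>X j\<close> acts as the constant \<open>x $ j\<close> plus the local coordinate.
  The constant leaves a shift; the local coordinate times the derivation multiplies the coefficient
  at \<open>p\<close> by \<open>p j\<close>.\<close>

lemma act_XD_taylor:
  "weyl_act x (weyl_X j * weyl_D j) (taylor g)
    = taylor (\<lambda>p. x $ j * g (p(j := Suc (p j))) + of_nat (p j) * g p)"
proof
  fix p :: "'a \<Rightarrow> nat"
  let ?h = "\<lambda>p. g (p(j := Suc (p j)))"
  have "weyl_act x (weyl_X j * weyl_D j) (taylor g) p
      = x $ j * taylor ?h p + (if p j = 0 then 0 else taylor ?h (p(j := p j - 1)))"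
    by (simp add: weyl_act_module act_D_taylor del: generator_act.simps(2) fun_upd_apply)
  also have "(if p j = 0 then 0 else taylor ?h (p(j := p j - 1))) = of_nat (p j) * taylor g p"
  proof (cases "p j = 0")
    case False
    define q where "q = p(j := p j - 1)"
    have p: "p = q(j := Suc (q j))" and "p j = Suc (q j)"
      using False by (auto simp: q_def fun_eq_iff)
    then have "taylor ?h q = of_nat (p j) * taylor g p"
      using prod_fact_upd_Suc[of q j] of_nat_neq_0[of "q j", where ?'a = complex]
      by (simp add: taylor_def del: of_nat_Suc fun_upd_apply)
    then show ?thesis using False by (simp add: q_def)
  qed simp
  finally show "weyl_act x (weyl_X j * weyl_D j) (taylor g) p
      = taylor (\<lambda>p. x $ j * g (p(j := Suc (p j))) + of_nat (p j) * g p) p"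
    by (simp add: taylor_def add_divide_distrib del: fun_upd_apply)
qed

lemma act_D_power_taylor:
  "weyl_act x (weyl_D j ^ n) (taylor g) = taylor (\<lambda>p. g (p(j := p j + n)))"
  by (induction n arbitrary: g)
     (simp_all add: weyl_act_module act_D_taylor del: generator_act.simps)

lemma act_D_monom_taylor:
  "weyl_act x (weyl_D_monom \<nu>) (taylor g) = taylor (\<lambda>p. g (p + \<nu>))"
proof -
  interpret comp_fun_commute "\<lambda>j P. weyl_D j ^ \<nu> j * P"
    by (rule weyl_D_power_comp_fun_commute)
  \<comment> \<open>For the induction over the fold, only the coordinates in \<open>S\<close> have
    been shifted so far.\<close>
  have "weyl_act x (Finite_Set.fold (\<lambda>j P. weyl_D j ^ \<nu> j * P) 1 S) (taylor g)
      = taylor (\<lambda>p. g (\<lambda>j. if j \<in> S then p j + \<nu> j else p j))" for S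
  proof (induction S rule: finite_induct[OF finite])
    case 1
    then show ?case by (simp add: weyl_act_module)
  next
    case (2 j S)
    have "(\<lambda>i. if i \<in> S then (p(j := p j + \<nu> j)) i + \<nu> i else (p(j := p j + \<nu> j)) i)
        = (\<lambda>i. if i \<in> insert j S then p i + \<nu> i else p i)" for p :: "'a \<Rightarrow> nat"
      using 2 by (auto simp: fun_eq_iff)
    then show ?case
      using 2 by (simp add: weyl_act_module act_D_power_taylor del: fun_upd_apply)
  qed
  from this[of UNIV] show ?thesis by (simp add: weyl_D_monom_def plus_fun_def)
qed

subsection \<open>The hypergeometric system as a recurrence\<close>

definition weight :: "int ^ 'k ^ 'd \<Rightarrow> ('k :: finite \<Rightarrow> nat) \<Rightarrow> int ^ 'd" where
  "weight A p = A *v (\<chi> j. int (p j))"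

lemma weight_nth: "weight A p $ l = (\<Sum>j\<in>UNIV. A $ l $ j * int (p j))"
  by (simp add: weight_def matrix_vector_mult_def)

lemma weight_plus: "weight A (p + q) = weight A p + weight A q"
  by (simp add: vec_eq_iff weight_nth algebra_simps sum.distrib)

lemma weight_upd_Suc: "weight A (p(j := Suc (p j))) $ l = weight A p $ l + A $ l $ j"
  by (simp add: weight_nth sum.remove[of UNIV j] algebra_simps)

text \<open>In the sum over all columns, the factors \<open>p j\<close> of
  \<open>act_XD_taylor\<close> combine to the \<open>l\<close>-th coordinate of the weight, and the
  shifts remain as a sum weighted by the base point.\<close>

lemma act_euler_taylor:
  "weyl_act x (euler_operator A l - weyl_const b) (taylor g)
    = taylor (\<lambda>p. (of_int (weight A p $ l) - b) * g p
        + (\<Sum>j\<in>UNIV. of_int (A $ l $ j) * x $ j * g (p(j := Suc (p j)))))"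
proof
  fix p
  let ?S = "\<lambda>p. \<Sum>j\<in>UNIV. of_int (A $ l $ j) * x $ j * g (p(j := Suc (p j)))"
  have "weyl_act x (of_int (A $ l $ j) * (weyl_X j * weyl_D j)) (taylor g) p
      = of_int (A $ l $ j)
        * taylor (\<lambda>p. x $ j * g (p(j := Suc (p j))) + of_nat (p j) * g p) p" for j
    by (simp only: weyl_act_module(3)[of x "of_int _"] weyl_act_of_int act_XD_taylor)
  then have "weyl_act x (euler_operator A l - weyl_const b) (taylor g) p
      = (\<Sum>j\<in>UNIV. of_int (A $ l $ j)
          * taylor (\<lambda>p. x $ j * g (p(j := Suc (p j))) + of_nat (p j) * g p) p) - b * taylor g p"
    by (simp only: euler_operator_def weyl_act_minus weyl_act_sum weyl_act_const fun_diff_def)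
  also have "\<dots> = taylor (\<lambda>p. of_int (weight A p $ l) * g p + ?S p) p - b * taylor g p"
    by (simp add: taylor_def weight_nth sum_distrib_left sum_distrib_right sum_divide_distrib
        add_divide_distrib distrib_left sum.distrib mult.assoc)
  also have "\<dots> = taylor (\<lambda>p. (of_int (weight A p $ l) - b) * g p + ?S p) p"
    by (simp add: taylor_def add_divide_distrib diff_divide_distrib left_diff_distrib)
  finally show "weyl_act x (euler_operator A l - weyl_const b) (taylor g) p
      = taylor (\<lambda>p. (of_int (weight A p $ l) - b) * g p + ?S p) p" .
qed

lemma taylor_annihilated_hypergeometric_iff:
  "taylor g \<in> annihilated (hypergeometric_ideal A \<beta>) x \<longleftrightarrow>
    (\<forall>\<nu> \<nu>'. weight A \<nu> = weight A \<nu>' \<longrightarrow> g \<nu> = g \<nu>') \<and>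
    (\<forall>l p. (of_int (weight A p $ l) - \<beta> $ l) * g p
        + (\<Sum>j\<in>UNIV. of_int (A $ l $ j) * x $ j * g (p(j := Suc (p j)))) = 0)"
    (is "?L \<longleftrightarrow> ?box \<and> ?euler")
proof -
  have "?L \<longleftrightarrow> (\<forall>P\<in>box_operators A. weyl_act x P (taylor g) = 0)
      \<and> (\<forall>l. weyl_act x (euler_operator A l - weyl_const (\<beta> $ l)) (taylor g) = 0)"
    unfolding hypergeometric_ideal_def annihilated_hull
    unfolding annihilated_def ball_Un ball_simps mem_Collect_eq by simp
  moreover have "(\<forall>P\<in>box_operators A. weyl_act x P (taylor g) = 0) \<longleftrightarrow>
      (\<forall>\<nu> \<nu>'. weight A \<nu> = weight A \<nu>' \<longrightarrow>
        weyl_act x (weyl_D_monom \<nu> - weyl_D_monom \<nu>') (taylor g) = 0)"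
    unfolding box_operators_def weight_def by blast
  moreover have "weyl_act x (weyl_D_monom \<nu> - weyl_D_monom \<nu>') (taylor g) = 0 \<longleftrightarrow>
      (\<lambda>p. g (p + \<nu>)) = (\<lambda>p. g (p + \<nu>'))" for \<nu> \<nu>'
    by (simp only: weyl_act_minus act_D_monom_taylor right_minus_eq taylor_inject)
  moreover have "(\<forall>l. weyl_act x (euler_operator A l - weyl_const (\<beta> $ l)) (taylor g) = 0)
      \<longleftrightarrow> ?euler"
    unfolding act_euler_taylor taylor_eq_0_iff by (simp only: fun_eq_iff zero_fun_apply)
  ultimately have "?L \<longleftrightarrow>
      (\<forall>\<nu> \<nu>'. weight A \<nu> = weight A \<nu>' \<longrightarrow> (\<lambda>p. g (p + \<nu>)) = (\<lambda>p. g (p + \<nu>'))) \<and> ?euler"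
      (is "_ \<longleftrightarrow> ?box' \<and> _")
    by (simp only:)
  \<comment> \<open>Evaluating the shifted functions at 0 gives one direction; additivity of the
    weight gives the other.\<close>
  moreover have "?box' \<longleftrightarrow> ?box"
  proof
    assume box: ?box'
    show ?box
    proof (intro allI impI)
      fix \<nu> \<nu>' :: "'a \<Rightarrow> nat" assume "weight A \<nu> = weight A \<nu>'"
      then have "g (0 + \<nu>) = g (0 + \<nu>')" using box by meson
      then show "g \<nu> = g \<nu>'" by simp
    qed
  next
    assume box: ?box
    show ?box'
    proof (intro allI impI ext)
      fix \<nu> \<nu>' p :: "'a \<Rightarrow> nat" assume "weight A \<nu> = weight A \<nu>'"
      then have "weight A (p + \<nu>) = weight A (p + \<nu>')" by (simp only: weight_plus)
      then show "g (p + \<nu>) = g (p + \<nu>')" using box by blast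
    qed
  qed
  ultimately show ?thesis by blast
qed

subsection \<open>The Cayley matrix\<close>

lemma cayley_matrix_nth [simp]:
  "cayley_matrix \<mu> $ Inl i $ j = (if i = fst (\<mu> j) then 1 else 0)"
  "cayley_matrix \<mu> $ Inr m $ j = snd (\<mu> j) $ m"
  by (simp_all add: cayley_matrix_def)

lemma weight_cayley_nonneg: "0 \<le> weight (cayley_matrix \<mu>) p $ Inl i"
  by (auto simp: weight_nth intro!: sum_nonneg)

text \<open>\<open>origin i\<close> is the index of the column (e_i, 0), which belongs to the
  lattice point 0 of the \<open>i\<close>-th polytope.\<close>

locale cayley =
  fixes \<mu> :: "'k :: finite \<Rightarrow> 'r :: finite \<times> (int ^ 'n)" and origin :: "'r \<Rightarrow> 'k"
  assumes eq_origin_iff: "\<mu> j = (i, 0) \<longleftrightarrow> j = origin i"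
begin

definition base_point :: "complex ^ 'k" where
  "base_point = (\<chi> j. if snd (\<mu> j) = 0 then 1 else 0)"

lemma \<mu>_origin [simp]: "\<mu> (origin i) = (i, 0)"
  by (simp add: eq_origin_iff)

lemma taylor_annihilated_iff:
  "taylor g \<in> annihilated (hypergeometric_ideal (cayley_matrix \<mu>) beta0) base_point \<longleftrightarrow>
    (\<forall>\<nu> \<nu>'. weight (cayley_matrix \<mu>) \<nu> = weight (cayley_matrix \<mu>) \<nu>' \<longrightarrow> g \<nu> = g \<nu>') \<and>
    (\<forall>i p. g (p(origin i := Suc (p (origin i))))
        = - (of_int (weight (cayley_matrix \<mu>) p $ Inl i) + 1) * g p) \<and>
    (\<forall>m p. weight (cayley_matrix \<mu>) p $ Inr m = 0 \<or> g p = 0)"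
proof -
  let ?S = "\<lambda>l p. \<Sum>j\<in>UNIV. of_int (cayley_matrix \<mu> $ l $ j) * base_point $ j
      * g (p(j := Suc (p j)))"
  let ?E = "\<lambda>l p. (of_int (weight (cayley_matrix \<mu>) p $ l) - beta0 $ l) * g p + ?S l p = 0"
  have "?E (Inl i) p \<longleftrightarrow> g (p(origin i := Suc (p (origin i))))
      = - (of_int (weight (cayley_matrix \<mu>) p $ Inl i) + 1) * g p" for i p
  proof -
    \<comment> \<open>Row \<open>Inl i\<close> selects the columns with first label
      \<open>i\<close>, and the base point those with lattice point 0; only \<open>origin i\<close>
      satisfies both.\<close>
    have "?S (Inl i) p = (\<Sum>j\<in>UNIV. if j = origin i then g (p(j := Suc (p j))) else 0)"
      by (rule sum.cong) (auto simp: base_point_def prod_eq_iff simp flip: eq_origin_iff)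
    then have "?S (Inl i) p = g (p(origin i := Suc (p (origin i))))" by simp
    moreover have "(beta0 :: complex ^ ('r + 'n)) $ Inl i = - 1" by (simp add: beta0_def)
    ultimately show ?thesis by (simp only: add_eq_0_iff diff_minus_eq_add mult_minus_left)
  qed
  moreover have "?E (Inr m) p \<longleftrightarrow> weight (cayley_matrix \<mu>) p $ Inr m = 0 \<or> g p = 0" for m p
  proof -
    \<comment> \<open>Where the base point is nonzero the lattice point is 0, so the matrix entry
      vanishes. With no shift left, the recurrence becomes a condition on the support of
      \<open>g\<close>.\<close>
    have "?S (Inr m) p = 0"
      by (rule sum.neutral) (auto simp: base_point_def)
    moreover have "(beta0 :: complex ^ ('r + 'n)) $ Inr m = 0" by (simp add: beta0_def)
    ultimately show ?thesis by (simp only: diff_zero add_0_right mult_eq_0_iff of_int_eq_0_iff)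
  qed
  ultimately show ?thesis
    unfolding taylor_annihilated_hypergeometric_iff split_sum_all by (simp only:)
qed

text \<open>At the base point, the derivative of order \<open>p\<close> of the product of the
  \<open>1 / f\<^sub>i\<close> is the product of the (-1)^d_i d_i! times t^v, where (d, v) is the
  weight of \<open>p\<close>. Its constant term is nonzero only for v = 0.\<close>

definition period :: "('k \<Rightarrow> nat) \<Rightarrow> complex" where
  "period p = (let u = weight (cayley_matrix \<mu>) p in
     if \<forall>m. u $ Inr m = 0
     then \<Prod>i\<in>UNIV. (-1) ^ nat (u $ Inl i) * fact (nat (u $ Inl i)) else 0)"

lemma period_zero [simp]: "period 0 = 1"
  by (simp add: period_def weight_nth)

lemma period_annihilated:
  "taylor period \<in> annihilated (hypergeometric_ideal (cayley_matrix \<mu>) beta0) base_point"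
  unfolding taylor_annihilated_iff
proof (intro conjI allI impI)
  fix i p
  let ?u = "weight (cayley_matrix \<mu>)" and ?q = "p(origin i := Suc (p (origin i)))"
  let ?F = "\<lambda>k. (-1) ^ nat k * fact (nat k) :: complex"
  \<comment> \<open>The added column is (e_i, 0), so \<open>p\<close> and \<open>?q\<close> fall
    into the same case of \<open>period\<close>.\<close>
  have Inr: "?u ?q $ Inr m = ?u p $ Inr m" for m
    by (simp add: weight_upd_Suc)
  have Inl: "?u ?q $ Inl i' = ?u p $ Inl i' + (if i' = i then 1 else 0)" for i'
    by (simp add: weight_upd_Suc)
  \<comment> \<open>The bound on \<open>k\<close> matters because \<open>nat\<close> truncates
    negative integers to 0; \<open>weight_cayley_nonneg\<close> supplies it.\<close>
  have F: "?F (k + 1) = - (of_int k + 1) * ?F k" if "0 \<le> k" for k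
    using that by (simp add: nat_add_distrib algebra_simps)
  have "(\<Prod>i'\<in>UNIV. ?F (?u ?q $ Inl i'))
      = - (of_int (?u p $ Inl i) + 1) * (\<Prod>i'\<in>UNIV. ?F (?u p $ Inl i'))"
  proof -
    have "(\<Prod>i'\<in>UNIV - {i}. ?F (?u ?q $ Inl i')) = (\<Prod>i'\<in>UNIV - {i}. ?F (?u p $ Inl i'))"
      by (rule prod.cong) (auto simp: Inl)
    moreover have "?F (?u ?q $ Inl i) = - (of_int (?u p $ Inl i) + 1) * ?F (?u p $ Inl i)"
      using F[OF weight_cayley_nonneg] Inl[of i] by simp
    ultimately show ?thesis
      unfolding prod.remove[OF finite UNIV_I, of _ i] by (simp only: mult.assoc)
  qed
  then show "period ?q = - (of_int (?u p $ Inl i) + 1) * period p"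
    unfolding period_def Let_def Inr by simp
qed (auto simp: period_def Let_def split: if_splits)

text \<open>The support condition kills all weights (d, v) with v nonzero. Each weight (d, 0) is
  attained by an exponent supported on the origins, from which the recurrence descends to
  \<open>g 0\<close>.\<close>

lemma annihilated_eq_0:
  assumes g: "taylor g \<in> annihilated (hypergeometric_ideal (cayley_matrix \<mu>) beta0) base_point"
    and "g 0 = 0"
  shows "g = 0"
proof
  fix p
  let ?u = "weight (cayley_matrix \<mu>)"
  note g = g[unfolded taylor_annihilated_iff]
  \<comment> \<open>The exponent with entry \<open>d i\<close> at \<open>origin i\<close> and 0
    elsewhere; its weight is (d, 0).\<close>
  define q where "q d = (\<lambda>j. if snd (\<mu> j) = 0 then d (fst (\<mu> j)) else 0)" for d :: "'r \<Rightarrow> nat"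
  have q0: "g (q d) = 0" for d
  proof (induction "\<Sum>i\<in>UNIV. d i" arbitrary: d)
    case 0
    then have "q d = 0" by (auto simp: q_def fun_eq_iff)
    then show ?case using \<open>g 0 = 0\<close> by (simp only:)
  next
    case (Suc n)
    then obtain i where i: "d i \<noteq> 0" by (metis sum.neutral nat.distinct(1))
    \<comment> \<open>Lowering one positive entry reduces the total degree by 1, and the recurrence
      expresses \<open>g (q d)\<close> as a multiple of \<open>g (q d')\<close>.\<close>
    define d' where "d' = d(i := d i - 1)"
    have "sum d' (UNIV - {i}) = sum d (UNIV - {i})"
      by (rule sum.cong) (auto simp: d'_def)
    then have "n = sum d' UNIV"
      using Suc(2) i by (simp add: sum.remove[of UNIV i] d'_def)
    then have "g (q d') = 0" by (rule Suc(1))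
    moreover have "q d = (q d')(origin i := Suc (q d' (origin i)))"
      using i by (auto simp: q_def d'_def fun_eq_iff prod_eq_iff simp flip: eq_origin_iff)
    moreover have "g ((q d')(origin i := Suc (q d' (origin i))))
        = - (of_int (?u (q d') $ Inl i) + 1) * g (q d')"
      using g by blast
    ultimately show ?case by (simp only: mult_zero_right)
  qed
  show "g p = 0 p"
  proof (cases "\<forall>m. ?u p $ Inr m = 0")
    case True
    \<comment> \<open>The first block of the weight is nonnegative, so \<open>nat\<close> loses
      nothing: \<open>q d\<close> has the same weight as \<open>p\<close>, and the box condition
      gives equal values.\<close>
    define d where "d i = nat (?u p $ Inl i)" for i
    have "?u (q d) $ l = ?u p $ l" for l
    proof (cases l)
      case (Inl i)
      have "?u (q d) $ Inl i = (\<Sum>j\<in>UNIV. if j = origin i then int (d i) else 0)"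
        unfolding weight_nth
        by (rule sum.cong) (auto simp: q_def prod_eq_iff simp flip: eq_origin_iff)
      then show ?thesis by (simp add: Inl d_def weight_cayley_nonneg)
    next
      case (Inr m)
      have "?u (q d) $ Inr m = 0" by (auto simp: weight_nth q_def intro!: sum.neutral)
      then show ?thesis using True by (simp add: Inr)
    qed
    then have "?u p = ?u (q d)" by (simp add: vec_eq_iff)
    then have "g p = g (q d)" using g by blast
    then show ?thesis using q0 by simp
  next
    case False
    then obtain m where "?u p $ Inr m \<noteq> 0" by blast
    then have "g p = 0" using g by blast
    then show ?thesis by simp
  qed
qed

theorem dim_Sol0_base_point:
  "sol.dim (Sol0 (hypergeometric_ideal (cayley_matrix \<mu>) beta0) base_point) = 1"
proof (rule dim_Sol0_eq_1)
  show "left_ideal (hypergeometric_ideal (cayley_matrix \<mu>) beta0)"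
    unfolding hypergeometric_ideal_def by (rule left_ideal_hull)
  show "taylor period \<in> annihilated (hypergeometric_ideal (cayley_matrix \<mu>) beta0) base_point"
    by (rule period_annihilated)
  show "taylor period \<noteq> 0" using period_zero by (auto simp del: period_zero)
next
  fix h assume h: "h \<in> annihilated (hypergeometric_ideal (cayley_matrix \<mu>) beta0) base_point"
  obtain g where g: "h = taylor g" using taylor_surj by blast
  \<comment> \<open>As \<open>period\<close> is 1 at 0, subtracting \<open>g 0\<close> times it
    leaves a solution that vanishes at 0, hence is zero by \<open>annihilated_eq_0\<close>.\<close>
  have "h + (\<lambda>m. - g 0 * taylor period m) = taylor (\<lambda>p. g p - g 0 * period p)"
    by (simp add: g taylor_def fun_eq_iff diff_divide_distrib)
  then have "taylor (\<lambda>p. g p - g 0 * period p)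
      \<in> annihilated (hypergeometric_ideal (cayley_matrix \<mu>) beta0) base_point"
    using annihilated_add[OF h annihilated_scale[OF period_annihilated]] by metis
  then have eq: "(\<lambda>p. g p - g 0 * period p) = 0" by (rule annihilated_eq_0) simp
  have "g p = g 0 * period p" for p using fun_cong[OF eq, of p] by simp
  then have "h m = g 0 * taylor period m" for m
    unfolding g taylor_def by (metis times_divide_eq_right)
  then have "h = (\<lambda>m. g 0 * taylor period m)" by (rule ext)
  then show "\<exists>c. h = (\<lambda>m. c * taylor period m)" by blast
qed

end

theorem corollary2p7:
  fixes \<Delta> :: "'r :: finite \<Rightarrow> (real ^ 'n) set"
    and \<mu> :: "'k :: finite \<Rightarrow> 'r \<times> (int ^ 'n)"
  assumes "\<And>i. lattice_polytope (\<Delta> i)"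
    and "\<And>i. 0 \<in> \<Delta> i"
    and "0 \<in> interior (\<Sum>i\<in>UNIV. \<Delta> i)"
    and "bij_betw \<mu> UNIV {(i, w). lattice_point w \<in> \<Delta> i}"
  shows "\<exists>x :: complex ^ 'k.
           sol.dim (Sol0 (hypergeometric_ideal (cayley_matrix \<mu>) beta0) x) = 1"
proof -
  have "lattice_point 0 = (0 :: real ^ 'n)" by (simp add: lattice_point_def vec_eq_iff)
  \<comment> \<open>Since 0 lies in every polytope, (e_i, 0) is a column for each \<open>i\<close>;
    injectivity of \<open>\<mu>\<close> then makes its index unique, so \<open>inv \<mu>\<close>
    provides the map \<open>origin\<close>.\<close>
  then have "(i, 0) \<in> range \<mu>" for i
    using assms(2) bij_betw_imp_surj_on[OF assms(4)] by simp
  moreover have "inj \<mu>" using assms(4) by (rule bij_betw_imp_inj_on)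
  ultimately interpret cayley \<mu> "\<lambda>i. inv \<mu> (i, 0)"
    by unfold_locales (metis f_inv_into_f inv_f_f)
  show ?thesis using dim_Sol0_base_point by blast
qed

end
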